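(* Let $k'\in\mathcal{K}_\omega$ and $k\in\mathrm{conj}(k')$. For every $f\in I_a^k(L^1)$, we have $$I_a^k \left(D_a^{k'}f\right)(x)= f(x),\quad \text{a.e. } x\in[a,b].$$ For every $f\in I_b^k(L^1)$, we have $$I_b^k \left(D_b^{k'}f\right)(x)= f(x),\quad \text{a.e. } x\in[a,b].$$
   Context: Let $a<b$ be real numbers, $\mathbb{R}_+=(0,+\infty)$, and $\Omega=\{(x,y)\in[a,b]\times[a,b] : x>y\}$. Fix a weight function $\omega:[a,b]\to\mathbb{R}_+$ such that $\omega,\omega^{-1}\in L^\infty([a,b];\mathbb{R})$, where $\omega^{-1}=1/\omega$. For a (measurable) kernel-function $k:\Omega\to\mathbb{R}_+$ put $F_k(y)=\int_y^b k(x,y)\omega(x)\,dx$ for $y\in[a,b)$ and $G_k(y)=\int_a^y k(y,x)\omega(x)\,dx$ for $y\in(a,b]$. Let $\mathcal{K}_\omega$ be the set of measurable $k:\Omega\to\mathbb{R}_+$ such that $F_k\in L^\infty([a,b);\mathbb{R})$ and $G_k\in L^\infty((a,b];\mathbb{R})$. For $k_1,k_2\in\mathcal{K}_\omega$ put $\delta_{k_1,k_2}(x,y)=\int_y^x k_1(x,z)k_2(z,y)\omega(z)\,dz$ for $(x,y)\in\Omega$. Kernels $k,k'\in\mathcal{K}_\omega$ are conjugate if $\delta_{k,k'}(x,y)=\delta_{k',k}(x,y)=1$ for all $(x,y)\in\Omega$; $\mathrm{conj}(k')$ is the set of $k\in\mathcal{K}_\omega$ such that $k$ and $k'$ are conjugate.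 For $k\in\mathcal{K}_\omega$ and $f\in L^1([a,b];\mathbb{R})$ the $k$-integrals are, for a.e. $x\in[a,b]$, $(I_a^kf)(x)=\int_a^x k(x,y)f(y)\omega(y)\,dy$ and $(I_b^kf)(x)=\int_x^b k(y,x)f(y)\omega(y)\,dy$. $I_a^k(L^1)$ (resp. $I_b^k(L^1)$) is the set of $f\in L^1([a,b];\mathbb{R})$ for which there is $\varphi\in L^1([a,b];\mathbb{R})$ with $f=I_a^k\varphi$ (resp. $f=I_b^k\varphi$) a.e. on $[a,b]$. A function in $L^1([a,b];\mathbb{R})$ has an absolutely continuous representative if it agrees a.e. with an absolutely continuous function on $[a,b]$, with which it is then identified. If $f\in L^1([a,b];\mathbb{R})$ and $I_a^{k'}f$ has an absolutely continuous representative, the left-sided $k'$-derivative of $f$ is $(D_a^{k'}f)(x)=\frac{1}{\omega(x)}\frac{d}{dx}(I_a^{k'}f)(x)$ for a.e. $x$. If $I_b^{k'}f$ has an absolutely continuous representative, the right-sided $k'$-derivative is $(D_b^{k'}f)(x)=-\frac{1}{\omega(x)}\frac{d}{dx}(I_b^{k'}f)(x)$ for a.e. $x$. An identity involving a $k'$-derivative asserts in particular that this derivative is defined. *)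

theory Defs
  imports "HOL-Analysis.Analysis"
begin

text \<open>
  Functions on a subset of the line or of the plane are total functions; only their values on
  that subset are used. Measurability, integrability and "almost everywhere" refer to Lebesgue
  measure restricted to the relevant set.
\<close>

definition triangle :: "real \<Rightarrow> real \<Rightarrow> (real \<times> real) set" where
  "triangle a b = {(x, y). x \<in> {a..b} \<and> y \<in> {a..b} \<and> x > y}"

definition Linf :: "real set \<Rightarrow> (real \<Rightarrow> real) set" where
  "Linf S = {f \<in> borel_measurable (lebesgue_on S). \<exists>C. AE x in lebesgue_on S. \<bar>f x\<bar> \<le> C}"

definition weight :: "real \<Rightarrow> real \<Rightarrow> (real \<Rightarrow> real) \<Rightarrow> bool" where
  "weight a b w \<longleftrightarrow>
     (\<forall>x\<in>{a..b}. w x > 0) \<and> w \<in> Linf {a..b} \<and> (\<lambda>x. 1 / w x) \<in> Linf {a..b}"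

text \<open>
  Integrals run over open or half-open intervals, so that kernels are only evaluated on the
  triangle.
\<close>

definition kernel_F :: "real \<Rightarrow> (real \<Rightarrow> real) \<Rightarrow> (real \<Rightarrow> real \<Rightarrow> real) \<Rightarrow> real \<Rightarrow> real" where
  "kernel_F b w k y = (\<integral>x. k x y * w x \<partial>lebesgue_on {y<..b})"

definition kernel_G :: "real \<Rightarrow> (real \<Rightarrow> real) \<Rightarrow> (real \<Rightarrow> real \<Rightarrow> real) \<Rightarrow> real \<Rightarrow> real" where
  "kernel_G a w k y = (\<integral>x. k y x * w x \<partial>lebesgue_on {a..<y})"

text \<open>
  The Bochner integral of a nonnegative function with infinite integral is 0 by convention. The two
  integrability conditions below exclude this, as they express that
  the positive functions \<open>F\<close> and \<open>G\<close> are finite almost everywhere.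
\<close>

definition kernels ::
    "real \<Rightarrow> real \<Rightarrow> (real \<Rightarrow> real) \<Rightarrow> (real \<Rightarrow> real \<Rightarrow> real) set" where
  "kernels a b w = {k.
     (\<forall>(x, y)\<in>triangle a b. k x y > 0) \<and>
     (\<lambda>(x, y). k x y) \<in> borel_measurable (lebesgue_on (triangle a b)) \<and>
     (AE y in lebesgue_on {a..<b}. integrable (lebesgue_on {y<..b}) (\<lambda>x. k x y * w x)) \<and>
     kernel_F b w k \<in> Linf {a..<b} \<and>
     (AE y in lebesgue_on {a<..b}. integrable (lebesgue_on {a..<y}) (\<lambda>x. k y x * w x)) \<and>
     kernel_G a w k \<in> Linf {a<..b}}"

definition kernel_delta ::
    "(real \<Rightarrow> real) \<Rightarrow> (real \<Rightarrow> real \<Rightarrow> real) \<Rightarrow> (real \<Rightarrow> real \<Rightarrow> real) \<Rightarrow> real \<Rightarrow> real \<Rightarrow> real" where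
  "kernel_delta w k1 k2 x y = (\<integral>z. k1 x z * k2 z y * w z \<partial>lebesgue_on {y<..<x})"

text \<open>
  Here no integrability condition is needed: a Bochner integral with value 1 is that of an
  integrable function.
\<close>

definition conjugate_kernels ::
    "real \<Rightarrow> real \<Rightarrow> (real \<Rightarrow> real) \<Rightarrow> (real \<Rightarrow> real \<Rightarrow> real) \<Rightarrow> (real \<Rightarrow> real \<Rightarrow> real) \<Rightarrow> bool" where
  "conjugate_kernels a b w k k' \<longleftrightarrow>
     k \<in> kernels a b w \<and> k' \<in> kernels a b w \<and>
     (\<forall>(x, y)\<in>triangle a b. kernel_delta w k k' x y = 1 \<and> kernel_delta w k' k x y = 1)"

definition conj_set ::
    "real \<Rightarrow> real \<Rightarrow> (real \<Rightarrow> real) \<Rightarrow> (real \<Rightarrow> real \<Rightarrow> real) \<Rightarrow> (real \<Rightarrow> real \<Rightarrow> real) set" where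
  "conj_set a b w k' = {k \<in> kernels a b w. conjugate_kernels a b w k k'}"

definition L1 :: "real \<Rightarrow> real \<Rightarrow> (real \<Rightarrow> real) set" where
  "L1 a b = {f. integrable (lebesgue_on {a..b}) f}"

definition left_integral ::
    "real \<Rightarrow> (real \<Rightarrow> real) \<Rightarrow> (real \<Rightarrow> real \<Rightarrow> real) \<Rightarrow> (real \<Rightarrow> real) \<Rightarrow> real \<Rightarrow> real" where
  "left_integral a w k f x = (\<integral>y. k x y * f y * w y \<partial>lebesgue_on {a..<x})"

definition right_integral ::
    "real \<Rightarrow> (real \<Rightarrow> real) \<Rightarrow> (real \<Rightarrow> real \<Rightarrow> real) \<Rightarrow> (real \<Rightarrow> real) \<Rightarrow> real \<Rightarrow> real" where
  "right_integral b w k f x = (\<integral>y. k y x * f y * w y \<partial>lebesgue_on {x<..b})"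

definition left_range ::
    "real \<Rightarrow> real \<Rightarrow> (real \<Rightarrow> real) \<Rightarrow> (real \<Rightarrow> real \<Rightarrow> real) \<Rightarrow> (real \<Rightarrow> real) set" where
  "left_range a b w k =
     {f \<in> L1 a b. \<exists>\<phi>\<in>L1 a b. AE x in lebesgue_on {a..b}. f x = left_integral a w k \<phi> x}"

definition right_range ::
    "real \<Rightarrow> real \<Rightarrow> (real \<Rightarrow> real) \<Rightarrow> (real \<Rightarrow> real \<Rightarrow> real) \<Rightarrow> (real \<Rightarrow> real) set" where
  "right_range a b w k =
     {f \<in> L1 a b. \<exists>\<phi>\<in>L1 a b. AE x in lebesgue_on {a..b}. f x = right_integral b w k \<phi> x}"

definition abs_continuous :: "real \<Rightarrow> real \<Rightarrow> (real \<Rightarrow> real) \<Rightarrow> bool" where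
  "abs_continuous a b F \<longleftrightarrow>
     (\<forall>\<epsilon>>0. \<exists>\<delta>>0. \<forall>(n::nat) u v.
        (\<forall>i<n. a \<le> u i \<and> u i \<le> v i \<and> v i \<le> b) \<and>
        disjoint_family_on (\<lambda>i. {u i<..<v i}) {..<n} \<and>
        (\<Sum>i<n. v i - u i) < \<delta> \<longrightarrow>
        (\<Sum>i<n. \<bar>F (v i) - F (u i)\<bar>) < \<epsilon>)"

definition is_ac_rep :: "real \<Rightarrow> real \<Rightarrow> (real \<Rightarrow> real) \<Rightarrow> (real \<Rightarrow> real) \<Rightarrow> bool" where
  "is_ac_rep a b g F \<longleftrightarrow>
     abs_continuous a b F \<and> (AE x in lebesgue_on {a..b}. g x = F x)"

definition has_ac_rep :: "real \<Rightarrow> real \<Rightarrow> (real \<Rightarrow> real) \<Rightarrow> bool" where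
  "has_ac_rep a b g \<longleftrightarrow> (\<exists>F. is_ac_rep a b g F)"

text \<open>
  For \<open>a < b\<close> two absolutely continuous representatives agree on all of \<open>[a, b]\<close>, so the choice
  does not matter for the derivative on the open interval.
\<close>

definition ac_rep :: "real \<Rightarrow> real \<Rightarrow> (real \<Rightarrow> real) \<Rightarrow> real \<Rightarrow> real" where
  "ac_rep a b g = (SOME F. is_ac_rep a b g F)"

text \<open>
  The \<open>k\<close>-derivatives of \<open>f\<close> are meaningful (almost everywhere on \<open>[a, b]\<close>) only under the
  corresponding \<open>has_left_deriv\<close>, \<open>has_right_deriv\<close> condition.
\<close>

definition has_left_deriv ::
    "real \<Rightarrow> real \<Rightarrow> (real \<Rightarrow> real) \<Rightarrow> (real \<Rightarrow> real \<Rightarrow> real) \<Rightarrow> (real \<Rightarrow> real) \<Rightarrow> bool" where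
  "has_left_deriv a b w k f \<longleftrightarrow> f \<in> L1 a b \<and> has_ac_rep a b (left_integral a w k f)"

definition left_deriv ::
    "real \<Rightarrow> real \<Rightarrow> (real \<Rightarrow> real) \<Rightarrow> (real \<Rightarrow> real \<Rightarrow> real) \<Rightarrow> (real \<Rightarrow> real) \<Rightarrow> real \<Rightarrow> real" where
  "left_deriv a b w k f x = 1 / w x * deriv (ac_rep a b (left_integral a w k f)) x"

definition has_right_deriv ::
    "real \<Rightarrow> real \<Rightarrow> (real \<Rightarrow> real) \<Rightarrow> (real \<Rightarrow> real \<Rightarrow> real) \<Rightarrow> (real \<Rightarrow> real) \<Rightarrow> bool" where
  "has_right_deriv a b w k f \<longleftrightarrow> f \<in> L1 a b \<and> has_ac_rep a b (right_integral b w k f)"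

definition right_deriv ::
    "real \<Rightarrow> real \<Rightarrow> (real \<Rightarrow> real) \<Rightarrow> (real \<Rightarrow> real \<Rightarrow> real) \<Rightarrow> (real \<Rightarrow> real) \<Rightarrow> real \<Rightarrow> real" where
  "right_deriv a b w k f x = - (1 / w x) * deriv (ac_rep a b (right_integral b w k f)) x"

end

(* Write f = I_a^k phi. For almost every x, Fubini and the conjugacy relation delta_{k',k} = 1 give
   (I_a^{k'} f)(x) = int_a^x phi(y) delta_{k',k}(x,y) w(y) dy = int_a^x phi w. The right-hand side
   is absolutely continuous with derivative phi w almost everywhere, so D_a^{k'} f = phi a.e., and
   applying I_a^k returns f. The right-sided case is the same computation for the transposed
   kernels, with delta_{k,k'} in place of delta_{k',k}. *)

theory Submission
  imports Defs
begin

text \<open>The interchange of integrals needs absolute integrability, and this comes from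
  positivity: \<open>k\<close> and \<open>k'\<close> are nonnegative, so integrating the absolute
  value over the middle variable again gives a truncation of the absolute value of
  \<open>\<phi> w\<close>, which is integrable because \<open>w\<close> is essentially bounded.
  Integrability in the middle variable is contained in conjugacy, since an integral with value 1 is
  not the default 0. It remains to read \<open>\<phi>\<close> off from its weighted primitive.
  Derivatives are taken of a representative fixed by \<open>SOME\<close>; it is pinned down because
  continuous functions that agree almost everywhere agree on the open interval. The primitive of a
  merely integrable function is differentiated almost everywhere by a covering argument for gauge
  integrals. The derivative equals \<open>\<phi>\<close> only up to a null set, which the kernel
  integral does not see. Both sides share one set of lemmas, with kernels extended by zero and, for
  the right side, transposed.\<close>

section \<open>Lebesgue differentiation on the line\<close>

text \<open>
  Vitali's theorem covers the exceptional set by disjoint intervals \<open>[x, y]\<close>, up to a null set.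
  Tagged by \<open>x\<close> they form a fine partial division, so Henstock's lemma bounds their total length.
\<close>

lemma negligible_indefinite_integral_deviation:
  fixes h :: "real \<Rightarrow> real"
  assumes h: "h integrable_on {a..b}" and "e > 0"
  defines "F \<equiv> \<lambda>x. integral {a..x} h"
  shows "negligible {x \<in> {a..b}. \<forall>d>0. \<exists>y\<in>{a..b}. y \<noteq> x \<and> \<bar>y - x\<bar> < d \<and>
           e * \<bar>y - x\<bar> \<le> \<bar>F y - F x - h x * (y - x)\<bar>}" (is "negligible ?E")
  unfolding negligible_outer_le
proof (intro allI impI)
  fix \<eta> :: real assume "\<eta> > 0"
  \<comment> \<open>Each interval of the cover contributes at least \<open>e\<close> times its
    length to the Henstock sum, so the tolerance \<open>e * \<eta>\<close> bounds the total length
    by \<open>\<eta>\<close>.\<close>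
  then have "e * \<eta> > 0" using \<open>e > 0\<close> by simp
  with h obtain \<gamma> where "gauge \<gamma>" and \<gamma>: "\<And>p. \<lbrakk>p tagged_partial_division_of (cbox a b); \<gamma> fine p\<rbrakk> \<Longrightarrow>
             (\<Sum>(x,K)\<in>p. norm (measure lborel K *\<^sub>R h x - integral K h)) < e * \<eta>"
    using Henstock_lemma[of h a b "e * \<eta>"] by auto
  \<comment> \<open>The covering theorem speaks of closed balls given by centre and radius. The ball
    of an index \<open>(x, y)\<close> is the interval between \<open>x\<close> and \<open>y\<close>,
    so the tag \<open>x\<close> is an endpoint of it, on either side.\<close>
  define c r where "c = (\<lambda>(x, y). (x + y) / 2 :: real)" and "r = (\<lambda>(x, y). \<bar>y - x\<bar> / 2 :: real)"
  define I where "I = (\<lambda>p. cball (c p) (r p))"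
  have I: "I (x, y) = {min x y..max x y}" for x y
    unfolding I_def c_def r_def by (auto simp: cball_eq_atLeastAtMost min_def max_def abs_if field_simps)
  have content_I: "measure lebesgue (I (x, y)) = \<bar>y - x\<bar>" "measure lborel (I (x, y)) = \<bar>y - x\<bar>" for x y
    unfolding I by (auto simp: min_def max_def)
  define P where "P = {(x, y). x \<in> {a..b} \<and> y \<in> {a..b} \<and> y \<noteq> x \<and> I (x, y) \<subseteq> \<gamma> x \<and>
      e * \<bar>y - x\<bar> \<le> \<bar>F y - F x - h x * (y - x)\<bar>}"
  have F_diff: "\<bar>measure lborel (I (x, y)) * h x - integral (I (x, y)) h\<bar> = \<bar>F y - F x - h x * (y - x)\<bar>"
    if "(x, y) \<in> P" for x y
  proof -
    have *: "F v - F u = integral {u..v} h" if "a \<le> u" "u \<le> v" "v \<le> b" for u v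
    proof -
      have "h integrable_on {a..v}" using h that by (auto intro: integrable_on_subinterval)
      from Henstock_Kurzweil_Integration.integral_combine[OF \<open>a \<le> u\<close> \<open>u \<le> v\<close> this]
      show ?thesis by (simp add: F_def)
    qed
    show ?thesis
    proof (cases "x \<le> y")
      case True
      then show ?thesis using that *[of x y] by (auto simp: P_def I algebra_simps)
    next
      case False
      then show ?thesis using that *[of y x] by (auto simp: P_def I algebra_simps)
    qed
  qed
  obtain C where C: "countable C" "C \<subseteq> P" "pairwise (\<lambda>i j. disjnt (I i) (I j)) C"
    and neg: "negligible (?E - (\<Union>i\<in>C. I i))"
    unfolding I_def
  proof (rule Vitali_covering_theorem_cballs[of P r ?E c])
    show "0 < r i" if "i \<in> P" for i using that by (auto simp: P_def r_def)
    show "\<exists>i. i \<in> P \<and> x \<in> cball (c i) (r i) \<and> r i < d" if x: "x \<in> ?E" and "0 < d" for x d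
    proof -
      have "open (\<gamma> x)" "x \<in> \<gamma> x" using \<open>gauge \<gamma>\<close> by (auto simp: gauge_def)
      then obtain s where "s > 0" and s: "ball x s \<subseteq> \<gamma> x"
        by (meson open_contains_ball)
      \<comment> \<open>Bad points \<open>y\<close> occur arbitrarily close to \<open>x\<close>;
        staying within \<open>s\<close> makes the interval fine for the gauge, staying within
        \<open>d\<close> makes it small enough for a Vitali cover.\<close>
      then obtain y where y: "y\<in>{a..b}" "y \<noteq> x" "\<bar>y - x\<bar> < min s d"
           "e * \<bar>y - x\<bar> \<le> \<bar>F y - F x - h x * (y - x)\<bar>"
        using x \<open>d > 0\<close> by (auto dest!: spec[of _ "min s d"])
      have "I (x, y) \<subseteq> ball x s"
        using y unfolding I by (auto simp: dist_real_def)
      then have "(x, y) \<in> P" using x y s by (auto simp: P_def)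
      moreover have "x \<in> cball (c (x, y)) (r (x, y))"
        using I[of x y] unfolding I_def by auto
      moreover have "r (x, y) < d" using y by (auto simp: r_def)
      ultimately show ?thesis by blast
    qed
  qed (use that in auto)
  have I_meas: "I i \<in> lmeasurable" for i by (simp add: I_def)
  \<comment> \<open>Henstock's lemma concerns finite partial divisions only; a bound common to all
    finite subfamilies then passes to the countable union.\<close>
  have fin: "measure lebesgue (\<Union>i\<in>D. I i) \<le> \<eta>" if D: "D \<subseteq> C" "finite D" for D
  proof -
    define p where "p = (\<lambda>i. (fst i, I i)) ` D"
    have DP: "D \<subseteq> P" using D C by auto
    have disj: "disjnt (I i) (I j)" if "i \<in> D" "j \<in> D" "i \<noteq> j" for i j
      using C(3) D that by (auto simp: pairwise_def)
    \<comment> \<open>The intervals are nonempty, so two equal ones could not be disjoint. This lets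
      the sum over tagged intervals be written as a sum over \<open>D\<close>.\<close>
    have inj: "inj_on (\<lambda>i. (fst i, I i)) D"
    proof (rule inj_onI, rule ccontr)
      fix i j assume *: "i \<in> D" "j \<in> D" "(fst i, I i) = (fst j, I j)" "i \<noteq> j"
      then have "I i = {}" using disj[of i j] by (auto simp: disjnt_def)
      then show False by (cases i) (auto simp: I)
    qed
    have "p tagged_partial_division_of (cbox a b)"
      unfolding tagged_partial_division_of_def
    proof (intro conjI allI impI)
      show "finite p" using D by (simp add: p_def)
      fix x K assume "(x, K) \<in> p"
      then obtain y where xy: "(x, y) \<in> D" and K: "K = I (x, y)" by (auto simp: p_def)
      show "x \<in> K" by (auto simp: K I)
      show "K \<subseteq> cbox a b" using xy DP by (auto simp: K I P_def)
      show "\<exists>a b. K = cbox a b" unfolding K I by (intro exI) (rule cbox_interval[symmetric])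
    next
      fix x1 K1 x2 K2 assume "(x1, K1) \<in> p \<and> (x2, K2) \<in> p \<and> (x1, K1) \<noteq> (x2, K2)"
      then obtain i j where "i \<in> D" "j \<in> D" "K1 = I i" "K2 = I j" "i \<noteq> j"
        by (auto simp: p_def)
      with disj[of i j] interior_subset[of K1] interior_subset[of K2]
      show "interior K1 \<inter> interior K2 = {}" by (auto simp: disjnt_def)
    qed
    moreover have "\<gamma> fine p"
      unfolding fine_def p_def
    proof clarsimp
      fix x y z assume "(x, y) \<in> D" "z \<in> I (x, y)"
      moreover from this DP have "I (x, y) \<subseteq> \<gamma> x" by (auto simp: P_def)
      ultimately show "z \<in> \<gamma> x" by blast
    qed
    ultimately have *: "(\<Sum>(x,K)\<in>p. norm (measure lborel K *\<^sub>R h x - integral K h)) < e * \<eta>" by (rule \<gamma>)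
    have "e * (\<Sum>i\<in>D. measure lebesgue (I i)) \<le> (\<Sum>i\<in>D. \<bar>measure lborel (I i) * h (fst i) - integral (I i) h\<bar>)"
      unfolding sum_distrib_left
    proof (rule sum_mono)
      fix i assume "i \<in> D"
      obtain x y where i: "i = (x, y)" by (cases i)
      have "(x, y) \<in> P" using \<open>i \<in> D\<close> DP i by auto
      from F_diff[OF this] this show "e * measure lebesgue (I i) \<le> \<bar>measure lborel (I i) * h (fst i) - integral (I i) h\<bar>"
        unfolding i by (simp only: content_I fst_conv) (auto simp: P_def)
    qed
    also have "\<dots> = (\<Sum>(x,K)\<in>p. norm (measure lborel K *\<^sub>R h x - integral K h))"
      unfolding p_def by (subst sum.reindex[OF inj]) (simp add: case_prod_unfold)
    finally have "e * (\<Sum>i\<in>D. measure lebesgue (I i)) \<le> e * \<eta>" using * by linarith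
    then have "(\<Sum>i\<in>D. measure lebesgue (I i)) \<le> \<eta>" using \<open>e > 0\<close> by simp
    moreover have "measure lebesgue (\<Union>i\<in>D. I i) \<le> (\<Sum>i\<in>D. measure lebesgue (I i))"
      by (rule measure_UNION_le) (use D I_meas in \<open>auto simp: fmeasurableD\<close>)
    ultimately show ?thesis by linarith
  qed
  let ?U = "\<Union>i\<in>C. I i"
  have U: "?U \<in> lmeasurable" "measure lebesgue ?U \<le> \<eta>"
    using fmeasurable_UN_bound[OF C(1) I_meas fin] measure_UN_bound[OF C(1) I_meas fin] by auto
  let ?T = "?U \<union> (?E - ?U)"
  have "?T \<in> lmeasurable" using U negligible_imp_measurable[OF neg] by (intro fmeasurable.Un)
  moreover have "measure lebesgue ?T \<le> \<eta>"
    using measure_Un_le[of ?U lebesgue "?E - ?U"] U negligible_imp_measure0[OF neg] negligible_imp_measurable[OF neg]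
    by (simp add: fmeasurableD)
  moreover have "?E \<subseteq> ?T" by blast
  ultimately show "\<exists>T. ?E \<subseteq> T \<and> T \<in> lmeasurable \<and> measure lebesgue T \<le> \<eta>" by blast
qed

text \<open>The tolerances \<open>1 / Suc n\<close> suffice, so the exceptional points lie in a
  countable union of the null sets just obtained.\<close>

lemma negligible_not_has_real_derivative_indefinite_integral:
  fixes h :: "real \<Rightarrow> real"
  assumes h: "h integrable_on {a..b}"
  shows "negligible {x \<in> {a<..<b}. \<not> ((\<lambda>x. integral {a..x} h) has_real_derivative h x) (at x)}"
    (is "negligible ?N")
proof -
  define F where "F = (\<lambda>x. integral {a..x} h)"
  define E where "E = (\<lambda>e. {x \<in> {a..b}. \<forall>d>0. \<exists>y\<in>{a..b}. y \<noteq> x \<and> \<bar>y - x\<bar> < d \<and>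
           e * \<bar>y - x\<bar> \<le> \<bar>F y - F x - h x * (y - x)\<bar>})"
  have "negligible (\<Union>n. E (1 / Suc n))"
    using negligible_indefinite_integral_deviation[OF h, of "1 / Suc n" for n]
    by (intro negligible_Union_nat) (auto simp: E_def F_def)
  moreover have "?N \<subseteq> (\<Union>n. E (1 / Suc n))"
  proof (rule subsetI, rule ccontr)
    fix x assume x: "x \<in> ?N" and "x \<notin> (\<Union>n. E (1 / Suc n))"
    then have notE: "x \<notin> E (1 / Suc n)" for n by auto
    have ab: "a < x" "x < b" using x by auto
    have "(F has_derivative (\<lambda>y. y * h x)) (at x)"
      unfolding has_derivative_within_alt
    proof (intro conjI allI impI)
      show "bounded_linear (\<lambda>y. y * h x)" by (rule bounded_linear_mult_left)
      fix e :: real assume "e > 0"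
      then obtain n where n: "1 / real (Suc n) < e"
        using nat_approx_posE by blast
      from notE[of n] ab obtain d where "d > 0" and nd: "\<not> (\<exists>y\<in>{a..b}. y \<noteq> x \<and> \<bar>y - x\<bar> < d \<and>
           1 / Suc n * \<bar>y - x\<bar> \<le> \<bar>F y - F x - h x * (y - x)\<bar>)"
        unfolding E_def mem_Collect_eq by (metis atLeastAtMost_iff less_imp_le)
      have d: "\<bar>F y - F x - h x * (y - x)\<bar> < 1 / Suc n * \<bar>y - x\<bar>"
        if "y \<in> {a..b}" "y \<noteq> x" "\<bar>y - x\<bar> < d" for y
        using nd that by (meson not_le)
      show "\<exists>d>0. \<forall>y\<in>UNIV. norm (y - x) < d \<longrightarrow> norm (F y - F x - (y - x) * h x) \<le> e * norm (y - x)"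
      \<comment> \<open>The distances to the endpoints keep \<open>y\<close> inside
        \<open>{a..b}\<close>, where the deviation is controlled.\<close>
      proof (intro exI[of _ "min d (min (x - a) (b - x))"] conjI ballI impI)
        fix y assume y: "norm (y - x) < min d (min (x - a) (b - x))"
        show "norm (F y - F x - (y - x) * h x) \<le> e * norm (y - x)"
        proof (cases "y = x")
          case False
          have "y \<in> {a..b}" using y by (auto simp: abs_if split: if_splits)
          with d False y have "\<bar>F y - F x - h x * (y - x)\<bar> < 1 / Suc n * \<bar>y - x\<bar>" by auto
          also have "\<dots> \<le> e * \<bar>y - x\<bar>" using n by (intro mult_right_mono) auto
          finally show ?thesis by (simp add: mult.commute)
        qed simp
      qed (use \<open>d > 0\<close> ab in auto)
    qed
    then have "(F has_real_derivative h x) (at x)"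
      by (simp add: has_field_derivative_def mult_commute_abs)
    with x show False by (simp add: F_def)
  qed
  ultimately show ?thesis by (rule negligible_subset)
qed

section \<open>Absolute continuity\<close>

text \<open>Pointwise the tail vanishes as soon as \<open>n\<close> exceeds the absolute value of
  \<open>h x\<close>, and that absolute value dominates throughout. The lemma splits an integrable
  function into a bounded part and one of small integral.\<close>

lemma lebesgue_integral_truncation_tail_tendsto_0:
  fixes h :: "real \<Rightarrow> real"
  assumes "integrable M h"
  shows "(\<lambda>n. \<integral>x. \<bar>h x\<bar> - min \<bar>h x\<bar> (real n) \<partial>M) \<longlonglongrightarrow> 0"
proof -
  have [measurable]: "h \<in> borel_measurable M" using assms by auto
  have "(\<lambda>n. \<integral>x. \<bar>h x\<bar> - min \<bar>h x\<bar> (real n) \<partial>M) \<longlonglongrightarrow> (\<integral>x. 0 \<partial>M)"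
  proof (rule integral_dominated_convergence[where w = "\<lambda>x. \<bar>h x\<bar>"])
    show "AE x in M. (\<lambda>n. \<bar>h x\<bar> - min \<bar>h x\<bar> (real n)) \<longlonglongrightarrow> 0"
    proof (rule AE_I2)
      fix x
      obtain N :: nat where N: "\<bar>h x\<bar> \<le> real N" using real_arch_simple by blast
      then have "\<forall>\<^sub>F n in sequentially. \<bar>h x\<bar> - min \<bar>h x\<bar> (real n) = 0"
        by (intro eventually_sequentiallyI[of N]) auto
      then show "(\<lambda>n. \<bar>h x\<bar> - min \<bar>h x\<bar> (real n)) \<longlonglongrightarrow> 0" by (rule tendsto_eventually)
    qed
  qed (use assms in auto)
  then show ?thesis by simp
qed

text \<open>The tail beyond height \<open>N\<close> contributes less than
  \<open>\<epsilon> / 2\<close> over all intervals together, the bounded part at most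
  \<open>N\<close> times their total length. The hypothesis compares absolute values, so that it
  fits integrals from \<open>a\<close> as well as integrals up to \<open>b\<close>.\<close>

lemma abs_continuous_indefinite_integral:
  fixes h :: "real \<Rightarrow> real"
  assumes h: "integrable lebesgue h"
    and F: "\<And>u v. \<lbrakk>a \<le> u; u \<le> v; v \<le> b\<rbrakk> \<Longrightarrow> \<bar>F v - F u\<bar> = \<bar>\<integral>x. indicator {u<..<v} x * h x \<partial>lebesgue\<bar>"
  shows "abs_continuous a b F"
  unfolding abs_continuous_def
proof (intro allI impI)
  fix \<epsilon> :: real assume "\<epsilon> > 0"
  let ?r = "\<lambda>N x. \<bar>h x\<bar> - min \<bar>h x\<bar> (real N)"
  have [measurable]: "h \<in> borel_measurable lebesgue" using h by auto
  from LIMSEQ_D[OF lebesgue_integral_truncation_tail_tendsto_0[OF h], of "\<epsilon> / 2"] \<open>\<epsilon> > 0\<close>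
  obtain N where "norm (integral\<^sup>L lebesgue (?r N) - 0) < \<epsilon> / 2" by auto
  then have N: "integral\<^sup>L lebesgue (?r N) < \<epsilon> / 2" by simp
  have intr: "integrable lebesgue (?r N)"
    by (rule Bochner_Integration.integrable_bound[OF h]) auto
  \<comment> \<open>Chosen so that \<open>real N * \<delta> \<le> \<epsilon> / 2\<close>; the added
    1 covers \<open>N = 0\<close>.\<close>
  define \<delta> where "\<delta> = \<epsilon> / (2 * (real N + 1))"
  have "\<delta> > 0" using \<open>\<epsilon> > 0\<close> by (simp add: \<delta>_def)
  show "\<exists>\<delta>>0. \<forall>(n::nat) u v. (\<forall>i<n. a \<le> u i \<and> u i \<le> v i \<and> v i \<le> b) \<and>
        disjoint_family_on (\<lambda>i. {u i<..<v i}) {..<n} \<and> (\<Sum>i<n. v i - u i) < \<delta> \<longrightarrow>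
        (\<Sum>i<n. \<bar>F (v i) - F (u i)\<bar>) < \<epsilon>"
  proof (intro exI[of _ \<delta>] conjI allI impI \<open>\<delta> > 0\<close>, elim conjE)
    fix n :: nat and u v :: "nat \<Rightarrow> real"
    assume uv: "\<forall>i<n. a \<le> u i \<and> u i \<le> v i \<and> v i \<le> b"
      and disj: "disjoint_family_on (\<lambda>i. {u i<..<v i}) {..<n}" and less: "(\<Sum>i<n. v i - u i) < \<delta>"
    let ?i = "\<lambda>i. indicator {u i<..<v i} :: real \<Rightarrow> real"
    have int_ir: "integrable lebesgue (\<lambda>x. ?i i x * ?r N x)" for i
      using integrable_mult_indicator[OF _ intr, of "{u i<..<v i}"] by simp
    have int_i: "integrable lebesgue (?i i)" for i
      using emeasure_bounded_finite[of "{u i<..<v i}"] by (simp add: integrable_indicator_iff)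
    have "\<bar>F (v i) - F (u i)\<bar> \<le> (\<integral>x. ?i i x * ?r N x \<partial>lebesgue) + real N * (v i - u i)" if "i < n" for i
    proof -
      have "\<bar>F (v i) - F (u i)\<bar> = \<bar>\<integral>x. ?i i x * h x \<partial>lebesgue\<bar>"
        using uv that by (intro F) auto
      also have "\<dots> \<le> (\<integral>x. \<bar>?i i x * h x\<bar> \<partial>lebesgue)" by (rule integral_abs_bound)
      also have "\<dots> \<le> (\<integral>x. ?i i x * ?r N x + real N * ?i i x \<partial>lebesgue)"
      proof (rule integral_mono)
        have "integrable lebesgue (\<lambda>x. ?i i x * h x)"
          using integrable_mult_indicator[OF _ h, of "{u i<..<v i}"] by simp
        then show "integrable lebesgue (\<lambda>x. \<bar>?i i x * h x\<bar>)" by (rule integrable_abs)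
        show "integrable lebesgue (\<lambda>x. ?i i x * ?r N x + real N * ?i i x)"
          using int_ir int_i by auto
      qed (auto simp: indicator_def)
      also have "\<dots> = (\<integral>x. ?i i x * ?r N x \<partial>lebesgue) + real N * (\<integral>x. ?i i x \<partial>lebesgue)"
        using int_ir[of i] int_i[of i] by simp
      also have "(\<integral>x. ?i i x \<partial>lebesgue) = v i - u i" using uv that by simp
      finally show ?thesis .
    qed
    then have "(\<Sum>i<n. \<bar>F (v i) - F (u i)\<bar>) \<le>
        (\<Sum>i<n. (\<integral>x. ?i i x * ?r N x \<partial>lebesgue) + real N * (v i - u i))"
      by (intro sum_mono) auto
    also have "\<dots> = (\<Sum>i<n. (\<integral>x. ?i i x * ?r N x \<partial>lebesgue)) + real N * (\<Sum>i<n. v i - u i)"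
      by (simp add: sum.distrib sum_distrib_left)
    also have "(\<Sum>i<n. (\<integral>x. ?i i x * ?r N x \<partial>lebesgue)) = (\<integral>x. (\<Sum>i<n. ?i i x * ?r N x) \<partial>lebesgue)"
      using int_ir by (intro Bochner_Integration.integral_sum[symmetric]) auto
    also have "\<dots> \<le> integral\<^sup>L lebesgue (?r N)"
    proof (rule integral_mono)
      show "integrable lebesgue (\<lambda>x. \<Sum>i<n. ?i i x * ?r N x)"
        by (rule Bochner_Integration.integrable_sum) (rule int_ir)
      fix x
      \<comment> \<open>Disjointness enters here: a point lies in at most one interval, so the tail
        is counted at most once.\<close>
      have "(\<Sum>i<n. ?i i x) = indicator (\<Union>i<n. {u i<..<v i}) x"
        using disj by (intro indicator_UN_disjoint[symmetric]) auto
      also have "\<dots> \<le> 1" by (simp add: indicator_def)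
      finally have "(\<Sum>i<n. ?i i x) * ?r N x \<le> 1 * ?r N x" by (intro mult_right_mono) auto
      then show "(\<Sum>i<n. ?i i x * ?r N x) \<le> ?r N x" by (simp add: sum_distrib_right)
    qed (rule intr)
    also have "integral\<^sup>L lebesgue (?r N) + real N * (\<Sum>i<n. v i - u i) < \<epsilon>"
    proof -
      have "real N * (\<Sum>i<n. v i - u i) \<le> real N * \<delta>" using less by (intro mult_left_mono) auto
      also have "\<dots> \<le> \<epsilon> / 2" using \<open>\<epsilon> > 0\<close> by (simp add: \<delta>_def field_simps)
      finally show ?thesis using N by linarith
    qed
    finally show "(\<Sum>i<n. \<bar>F (v i) - F (u i)\<bar>) < \<epsilon>" by simp
  qed
qed

text \<open>This is the case of a single interval, \<open>n = 1\<close>, in the definition.\<close>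

lemma abs_continuous_imp_continuous_on:
  assumes "abs_continuous a b F"
  shows "continuous_on {a..b} F"
  unfolding continuous_on_iff
proof (intro ballI allI impI)
  fix x e :: real assume x: "x \<in> {a..b}" and "e > 0"
  obtain d where "d > 0" and d: "\<forall>(n::nat) u v.
        (\<forall>i<n. a \<le> u i \<and> u i \<le> v i \<and> v i \<le> b) \<and>
        disjoint_family_on (\<lambda>i. {u i<..<v i}) {..<n} \<and> (\<Sum>i<n. v i - u i) < d \<longrightarrow>
        (\<Sum>i<n. \<bar>F (v i) - F (u i)\<bar>) < e"
    using assms[unfolded abs_continuous_def, THEN spec, THEN mp, OF \<open>e > 0\<close>]
    by (elim exE conjE) (rule that)
  have *: "\<bar>F v - F u\<bar> < e" if "a \<le> u" "u \<le> v" "v \<le> b" "v - u < d" for u v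
    using d[rule_format, of 1 "\<lambda>_. u" "\<lambda>_. v"] that by (simp add: disjoint_family_on_def)
  show "\<exists>d>0. \<forall>x'\<in>{a..b}. dist x' x < d \<longrightarrow> dist (F x') (F x) < e"
  proof (intro exI[of _ d] conjI ballI impI \<open>d > 0\<close>)
    fix y assume "y \<in> {a..b}" "dist y x < d"
    then show "dist (F y) (F x) < e"
      using *[of x y] *[of y x] x by (cases "x \<le> y") (auto simp: dist_real_def abs_minus_commute)
  qed
qed

text \<open>The points of the open interval where \<open>F\<close> and \<open>G\<close> differ form
  a set that is both open and null, hence empty.\<close>

lemma continuous_on_AE_eq_imp_eq:
  fixes F G :: "real \<Rightarrow> real"
  assumes "continuous_on {a..b} F" "continuous_on {a..b} G" "AE x in lebesgue_on {a..b}. F x = G x"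
    and x: "x \<in> {a<..<b}"
  shows "F x = G x"
proof -
  have "AE x in lebesgue. x \<in> {a..b} \<longrightarrow> F x = G x"
    using assms(3) by (simp add: AE_restrict_space_iff)
  then have neg: "negligible {x. \<not> (x \<in> {a..b} \<longrightarrow> F x = G x)}"
    unfolding eventually_ae_filter_negligible using negligible_subset by blast
  have "open ({a<..<b} \<inter> (\<lambda>x. F x - G x) -` (- {0}))"
    using assms(1,2)
    by (intro continuous_open_preimage continuous_intros) (auto intro: continuous_on_subset)
  moreover have "negligible ({a<..<b} \<inter> (\<lambda>x. F x - G x) -` (- {0}))"
    by (rule negligible_subset[OF neg]) auto
  ultimately have "{a<..<b} \<inter> (\<lambda>x. F x - G x) -` (- {0}) = {}"
    using open_not_negligible by blast
  then show ?thesis using x by auto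
qed

text \<open>The chosen representative and \<open>F\<close> agree almost everywhere through
  \<open>g\<close>, and continuity removes the exceptional set. The open interval is enough for
  derivatives at interior points.\<close>

lemma ac_rep_eq:
  assumes "is_ac_rep a b g F" "x \<in> {a<..<b}"
  shows "ac_rep a b g x = F x"
proof -
  have G: "is_ac_rep a b g (ac_rep a b g)"
    unfolding ac_rep_def by (rule someI[of "is_ac_rep a b g", OF assms(1)])
  have "AE x in lebesgue_on {a..b}. ac_rep a b g x = F x"
    using G assms(1) unfolding is_ac_rep_def by auto
  moreover have "continuous_on {a..b} F" "continuous_on {a..b} (ac_rep a b g)"
    using G assms(1) abs_continuous_imp_continuous_on unfolding is_ac_rep_def by blast+
  ultimately show ?thesis
    using assms(2) by (intro continuous_on_AE_eq_imp_eq[of a b]) auto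
qed

section \<open>Fubini's theorem for Lebesgue measurable kernels\<close>

text \<open>The passage between \<open>lebesgue\<close> and \<open>lborel\<close>, the latter being
  where Fubini's theorem is applied. Measurability of \<open>f\<close> follows from that of
  \<open>g\<close> because \<open>lebesgue\<close> is complete.\<close>

lemma
  fixes f g :: "'a::euclidean_space \<Rightarrow> real"
  assumes g: "g \<in> borel_measurable borel" and eq: "AE x in lborel. f x = g x"
  shows integrable_lebesgue_iff_borel_version: "integrable lebesgue f \<longleftrightarrow> integrable lborel g"
    and integral_lebesgue_eq_borel_version: "integral\<^sup>L lebesgue f = integral\<^sup>L lborel g"
proof -
  have g': "g \<in> borel_measurable lborel" using g by simp
  have gl: "g \<in> borel_measurable lebesgue" using g' by (rule measurable_completion)
  have "AE x in lebesgue. g x = f x" using AE_completion[OF eq] by (simp add: eq_commute)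
  from borel_measurable_AE[OF gl this] this gl
  show "integrable lebesgue f \<longleftrightarrow> integrable lborel g" "integral\<^sup>L lebesgue f = integral\<^sup>L lborel g"
    using integrable_cong_AE[of g lebesgue f] integral_cong_AE[of g lebesgue f]
      integrable_completion[OF g'] integral_completion[OF g'] by auto
qed

text \<open>The swap is its own inverse, so its preimages are images under a linear map, and these
  preserve Lebesgue measurable sets. The lemma serves the transposed kernels of the right-sided
  case.\<close>

lemma borel_measurable_lebesgue_swap:
  fixes f :: "real \<times> real \<Rightarrow> real"
  assumes "f \<in> borel_measurable lebesgue"
  shows "(\<lambda>p. f (prod.swap p)) \<in> borel_measurable lebesgue"
proof -
  have "linear (prod.swap :: real \<times> real \<Rightarrow> real \<times> real)"
    by (auto simp: linear_iff prod_eq_iff)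
  then have sets: "prod.swap ` A \<in> sets lebesgue" if "A \<in> sets lebesgue" for A :: "(real \<times> real) set"
    using that by (intro differentiable_image_in_sets_lebesgue)
      (auto intro: linear_imp_differentiable_on)
  have "(prod.swap :: real \<times> real \<Rightarrow> real \<times> real) \<in> measurable lebesgue lebesgue"
  proof (rule measurableI)
    fix A :: "(real \<times> real) set" assume "A \<in> sets lebesgue"
    moreover have "prod.swap -` A = prod.swap ` A" by force
    ultimately show "prod.swap -` A \<inter> space lebesgue \<in> sets lebesgue" using sets by simp
  qed simp
  from measurable_compose[OF this assms] show ?thesis .
qed

lemma AE_lborel_pair:
  fixes P :: "'a::euclidean_space \<times> 'b::euclidean_space \<Rightarrow> bool"
  assumes "AE p in lborel. P p"
  shows "AE x in lborel. AE y in lborel. P (x, y)"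
proof -
  have "AE p in lborel \<Otimes>\<^sub>M lborel. P p" unfolding lborel_prod by (rule assms)
  then show ?thesis by (rule lborel_pair.AE_pair)
qed

text \<open>Exchanging the two quantifiers requires a measurable exceptional set. That of
  \<open>P\<close> need not be measurable, so it is first enclosed in a Borel null set
  \<open>N\<close>.\<close>

lemma AE_lborel_pair_swap:
  fixes P :: "'a::euclidean_space \<times> 'b::euclidean_space \<Rightarrow> bool"
  assumes "AE p in lborel. P p"
  shows "AE y in lborel. AE x in lborel. P (x, y)"
proof -
  obtain N where null: "N \<in> null_sets lborel" and sub: "{p. \<not> P p} \<subseteq> N"
    using assms unfolding eventually_ae_filter by auto
  then have N: "N \<in> sets borel" by (auto dest: null_setsD2)
  have "AE p in lborel. p \<notin> N" using null by (rule AE_not_in)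
  from AE_lborel_pair[OF this] have "AE x in lborel. AE y in lborel. (x, y) \<notin> N" .
  moreover have "{p \<in> space (lborel \<Otimes>\<^sub>M lborel). (fst p, snd p) \<notin> N} \<in> sets (lborel \<Otimes>\<^sub>M lborel)"
    unfolding lborel_prod using N by (simp add: Collect_neg_eq)
  ultimately have "AE y in lborel. AE x in lborel. (x, y) \<notin> N"
    using lborel_pair.AE_commute[where P = "\<lambda>x y. (x, y) \<notin> N"] by blast
  then show ?thesis
    by eventually_elim (erule eventually_mono, use sub in blast)
qed

text \<open>
  A section of a Lebesgue measurable function of two variables need not be measurable, so the
  kernels are replaced by Borel functions; this is why the identity only holds for almost all \<open>x\<close>.
\<close>

lemma iterated_integral_of_composed_kernels:
  fixes K L :: "real \<Rightarrow> real \<Rightarrow> real" and W g :: "real \<Rightarrow> real" and S :: "real \<Rightarrow> real set"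
  assumes K: "case_prod K \<in> borel_measurable lebesgue" and K0: "\<And>x z. 0 \<le> K x z"
    and L: "case_prod L \<in> borel_measurable lebesgue" and L0: "\<And>z y. 0 \<le> L z y"
    and W: "W \<in> borel_measurable lebesgue" and W0: "\<And>z. 0 \<le> W z"
    and g: "integrable lebesgue g"
    and S: "\<And>x. x \<in> X \<Longrightarrow> S x \<in> sets borel"
    and comp: "\<And>x y. x \<in> X \<Longrightarrow> has_bochner_integral lebesgue (\<lambda>z. K x z * W z * L z y) (indicator (S x) y)"
  shows "AE x in lborel. x \<in> X \<longrightarrow>
    (\<integral>z. K x z * W z * (\<integral>y. L z y * g y \<partial>lebesgue) \<partial>lebesgue) = (\<integral>y. indicator (S x) y * g y \<partial>lebesgue)"
proof -
  obtain KB where KB [measurable]: "KB \<in> borel_measurable borel" and KBeq: "AE p in lborel. case_prod K p = KB p"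
    using completion_ex_borel_measurable_real[OF K] by auto
  obtain LB where LB [measurable]: "LB \<in> borel_measurable borel" and LBeq: "AE p in lborel. case_prod L p = LB p"
    using completion_ex_borel_measurable_real[OF L] by auto
  obtain WB where WB [measurable]: "WB \<in> borel_measurable borel" and WBeq: "AE z in lborel. W z = WB z"
    using completion_ex_borel_measurable_real[OF W] by auto
  obtain gB where gB [measurable]: "gB \<in> borel_measurable borel" and gBeq: "AE y in lborel. g y = gB y"
    using completion_ex_borel_measurable_real[of g lborel] g by auto
  have gBint: "integrable lborel gB"
    using g integrable_lebesgue_iff_borel_version[OF gB gBeq] by simp
  \<comment> \<open>Both orders are used: \<open>L2\<close> for the integral over \<open>z\<close>
    at fixed \<open>y\<close>, where conjugacy applies, and \<open>L1\<close> for the integral over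
    \<open>y\<close> at fixed \<open>z\<close>.\<close>
  have L1: "AE z in lborel. AE y in lborel. L z y = LB (z, y)"
    using AE_lborel_pair[OF LBeq] by simp
  have L2: "AE y in lborel. AE z in lborel. L z y = LB (z, y)"
    using AE_lborel_pair_swap[OF LBeq] by simp
  have "AE x in lborel. AE z in lborel. K x z = KB (x, z)"
    using AE_lborel_pair[OF KBeq] by simp
  then show ?thesis
  proof eventually_elim
    case (elim x)
    show ?case
    proof
      assume x: "x \<in> X"
      note S[OF x, measurable]
      \<comment> \<open>The outer variable comes first: the inner integral over \<open>z\<close> is
        the one whose value \<open>comp\<close> supplies.\<close>
      define H where "H = (\<lambda>(y, z). KB (x, z) * WB z * LB (z, y) * gB y)"
      have H [measurable]: "H \<in> borel_measurable (lborel \<Otimes>\<^sub>M lborel)"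
        unfolding H_def by measurable
      have inner: "AE y in lborel. integrable lborel (\<lambda>z. H (y, z)) \<and>
          (\<integral>z. H (y, z) \<partial>lborel) = indicator (S x) y * gB y \<and>
          (\<integral>z. norm (H (y, z)) \<partial>lborel) = indicator (S x) y * \<bar>gB y\<bar>"
        using L2
      proof eventually_elim
        case (elim y)
        let ?p = "\<lambda>z. KB (x, z) * WB z * LB (z, y)"
        have eq: "AE z in lborel. K x z * W z * L z y = ?p z"
          using elim \<open>AE z in lborel. K x z = KB (x, z)\<close> WBeq by eventually_elim simp
        have p: "?p \<in> borel_measurable borel" by measurable
        have int: "integrable lborel ?p" and val: "integral\<^sup>L lborel ?p = indicator (S x) y"
          using comp[OF x, of y] integrable_lebesgue_iff_borel_version[OF p eq]
            integral_lebesgue_eq_borel_version[OF p eq] by (auto simp: has_bochner_integral_iff)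
        \<comment> \<open>Positivity of the kernels turns the known integral into an integral of
          absolute values, which is what absolute integrability of \<open>H\<close> requires. The
          Borel versions are nonnegative only almost everywhere.\<close>
        have "AE z in lborel. \<bar>?p z\<bar> = ?p z"
          using eq by eventually_elim (metis K0 L0 W0 abs_of_nonneg mult_nonneg_nonneg)
        then have val': "(\<integral>z. \<bar>?p z\<bar> \<partial>lborel) = indicator (S x) y"
          using val by (subst integral_cong_AE[where g = ?p]) auto
        show ?case
          using int val val' by (simp add: H_def abs_mult)
      qed
      have Hint: "integrable (lborel \<Otimes>\<^sub>M lborel) H"
      proof (rule lborel_pair.Fubini_integrable)
        have "integrable lborel (\<lambda>y. indicator (S x) y * \<bar>gB y\<bar>)"
          using integrable_mult_indicator[of "S x" lborel "\<lambda>y. \<bar>gB y\<bar>"] gBint S[OF x] by simp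
        then show "integrable lborel (\<lambda>y. \<integral>z. norm (H (y, z)) \<partial>lborel)"
          by (rule integrable_cong_AE_imp) (use inner in \<open>auto elim!: AE_mp\<close>)
        show "AE y in lborel. integrable lborel (\<lambda>z. H (y, z))"
          using inner by eventually_elim simp
      qed simp
      have "(\<integral>z. K x z * W z * (\<integral>y. L z y * g y \<partial>lebesgue) \<partial>lebesgue) = (\<integral>z. (\<integral>y. H (y, z) \<partial>lborel) \<partial>lborel)"
      proof (rule integral_lebesgue_eq_borel_version)
        show "AE z in lborel. K x z * W z * (\<integral>y. L z y * g y \<partial>lebesgue) = (\<integral>y. H (y, z) \<partial>lborel)"
          using elim WBeq L1
        proof eventually_elim
          case (elim z)
          have "AE y in lborel. L z y * g y = LB (z, y) * gB y"
            using elim(3) gBeq by eventually_elim simp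
          then have "(\<integral>y. L z y * g y \<partial>lebesgue) = (\<integral>y. LB (z, y) * gB y \<partial>lborel)"
            by (intro integral_lebesgue_eq_borel_version) auto
          then show ?case
            using elim by (simp add: H_def mult.assoc)
        qed
        have "(\<lambda>z. \<integral>y. H (y, z) \<partial>lborel) \<in> borel_measurable lborel" by measurable
        then show "(\<lambda>z. \<integral>y. H (y, z) \<partial>lborel) \<in> borel_measurable borel" by simp
      qed
      also have "\<dots> = (\<integral>y. (\<integral>z. H (y, z) \<partial>lborel) \<partial>lborel)"
        using lborel_pair.Fubini_integral[of "\<lambda>y z. H (y, z)"] Hint by simp
      also have "\<dots> = (\<integral>y. indicator (S x) y * gB y \<partial>lborel)"
        by (rule integral_cong_AE) (use inner in \<open>auto elim!: AE_mp\<close>)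
      also have "\<dots> = (\<integral>y. indicator (S x) y * g y \<partial>lebesgue)"
        by (rule integral_lebesgue_eq_borel_version[symmetric]) (use gBeq in \<open>auto elim!: AE_mp\<close>)
      finally show "(\<integral>z. K x z * W z * (\<integral>y. L z y * g y \<partial>lebesgue) \<partial>lebesgue) =
          (\<integral>y. indicator (S x) y * g y \<partial>lebesgue)" .
    qed
  qed
qed

text \<open>By completeness, almost everywhere equality transports measurability. Either both
  functions are measurable, or neither is integrable and both integrals take the default value
  0.\<close>

lemma
  fixes f g :: "'a::euclidean_space \<Rightarrow> real"
  assumes "AE x in lebesgue. f x = g x"
  shows integrable_lebesgue_cong_AE: "integrable lebesgue f \<longleftrightarrow> integrable lebesgue g"
    and integral_lebesgue_cong_AE: "integral\<^sup>L lebesgue f = integral\<^sup>L lebesgue g"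
proof -
  have "AE x in lebesgue. g x = f x" using assms by eventually_elim simp
  then have meas: "f \<in> borel_measurable lebesgue \<longleftrightarrow> g \<in> borel_measurable lebesgue"
    using borel_measurable_AE assms by blast
  show int: "integrable lebesgue f \<longleftrightarrow> integrable lebesgue g"
    using integrable_cong_AE[OF _ _ assms] meas borel_measurable_integrable by blast
  show "integral\<^sup>L lebesgue f = integral\<^sup>L lebesgue g"
  proof (cases "f \<in> borel_measurable lebesgue")
    case True
    then show ?thesis using integral_cong_AE[OF _ _ assms] meas by blast
  next
    case False
    then have "\<not> integrable lebesgue f" "\<not> integrable lebesgue g"
      using meas borel_measurable_integrable by blast+
    then show ?thesis by (simp add: not_integrable_integral_eq)
  qed
qed

section \<open>Kernel integrals and their derivatives\<close>

text \<open>
  After extension by zero all integrals run over the whole line, and the left- and right-sided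
  integrals differ only by a transposition of the kernel.
\<close>

definition kernel_ext :: "real \<Rightarrow> real \<Rightarrow> (real \<Rightarrow> real \<Rightarrow> real) \<Rightarrow> real \<Rightarrow> real \<Rightarrow> real" where
  "kernel_ext a b k x y = (if (x, y) \<in> triangle a b then k x y else 0)"

text \<open>Absorbing the weight into the function leaves plain kernel integrals;
  \<open>weighted a b w (\<lambda>_. 1)\<close> is the weight itself, extended by zero.\<close>

definition weighted :: "real \<Rightarrow> real \<Rightarrow> (real \<Rightarrow> real) \<Rightarrow> (real \<Rightarrow> real) \<Rightarrow> real \<Rightarrow> real" where
  "weighted a b w f y = (if y \<in> {a..b} then f y * w y else 0)"

lemma triangle_in_sets_lebesgue: "triangle a b \<in> sets lebesgue"
proof -
  have "triangle a b = ({a..b} \<times> {a..b}) \<inter> {p. snd p < fst p}"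
    by (auto simp: triangle_def)
  moreover have "closed ({a..b} \<times> {a..b})" by (intro closed_Times) auto
  moreover have "open {p. snd p < (fst p :: real)}"
    by (intro open_Collect_less continuous_intros)
  ultimately have "triangle a b \<in> sets borel" by (metis borel_closed borel_open sets.Int)
  then show ?thesis by simp
qed

lemma kernel_ext_measurable:
  assumes "k \<in> kernels a b w"
  shows "case_prod (kernel_ext a b k) \<in> borel_measurable lebesgue"
proof -
  have "(\<lambda>(x, y). k x y) \<in> borel_measurable (lebesgue_on (triangle a b))"
    using assms by (auto simp: kernels_def)
  from borel_measurable_if_I[OF this triangle_in_sets_lebesgue]
  moreover have "case_prod (kernel_ext a b k) = (\<lambda>p. if p \<in> triangle a b then (\<lambda>(x, y). k x y) p else 0)"
    by (auto simp: fun_eq_iff kernel_ext_def)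
  ultimately show ?thesis by simp
qed

lemma kernel_ext_nonneg:
  assumes "k \<in> kernels a b w"
  shows "0 \<le> kernel_ext a b k x y"
  using assms by (force simp: kernels_def kernel_ext_def intro: less_imp_le)

lemma L1_iff: "f \<in> L1 a b \<longleftrightarrow> integrable lebesgue (\<lambda>x. if x \<in> {a..b} then f x else 0)"
  unfolding L1_def mem_Collect_eq by (rule Lebesgue_Measure.integrable_restrict_UNIV[symmetric]) simp

lemma weighted_one_measurable:
  assumes "weight a b w"
  shows "weighted a b w (\<lambda>_. 1) \<in> borel_measurable lebesgue"
proof -
  have "w \<in> borel_measurable (lebesgue_on {a..b})" using assms by (simp add: weight_def Linf_def)
  then have "(\<lambda>y. if y \<in> {a..b} then w y else 0) \<in> borel_measurable lebesgue"
    by (rule borel_measurable_if_I) simp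
  also have "(\<lambda>y. if y \<in> {a..b} then w y else 0) = weighted a b w (\<lambda>_. 1)"
    by (simp add: fun_eq_iff weighted_def)
  finally show ?thesis .
qed

text \<open>Essential boundedness of \<open>w\<close> gives domination by a multiple of
  \<open>f\<close>.\<close>

lemma weighted_integrable:
  assumes w: "weight a b w" and f: "f \<in> L1 a b"
  shows "integrable lebesgue (weighted a b w f)"
proof -
  let ?f = "\<lambda>x. if x \<in> {a..b} then f x else 0"
  have f': "integrable lebesgue ?f" using f by (simp only: L1_iff)
  obtain C where C: "AE x in lebesgue_on {a..b}. \<bar>w x\<bar> \<le> C"
    using w by (auto simp: weight_def Linf_def)
  have eq: "weighted a b w f = (\<lambda>x. ?f x * weighted a b w (\<lambda>_. 1) x)"
    by (auto simp: weighted_def)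
  show ?thesis
  proof (rule Bochner_Integration.integrable_bound)
    show "integrable lebesgue (\<lambda>x. C * ?f x)" using f' by (rule integrable_mult_right)
    show "weighted a b w f \<in> borel_measurable lebesgue"
      unfolding eq using f' weighted_one_measurable[OF w] by (intro borel_measurable_times) auto
    have "AE x in lebesgue. x \<in> {a..b} \<longrightarrow> \<bar>w x\<bar> \<le> C"
      using C by (simp add: AE_restrict_space_iff)
    then show "AE x in lebesgue. norm (weighted a b w f x) \<le> norm (C * ?f x)"
    proof eventually_elim
      case (elim x)
      show ?case
      proof (cases "x \<in> {a..b}")
        case True
        then have "\<bar>f x\<bar> * \<bar>w x\<bar> \<le> \<bar>f x\<bar> * \<bar>C\<bar>" using elim by (intro mult_left_mono) auto
        then show ?thesis using True by (simp add: weighted_def abs_mult mult.commute)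
      qed (auto simp: weighted_def)
    qed
  qed
qed

lemma left_integral_eq:
  assumes "x \<in> {a..b}"
  shows "left_integral a w k f x = (\<integral>y. kernel_ext a b k x y * weighted a b w f y \<partial>lebesgue)"
proof -
  have "left_integral a w k f x = (\<integral>y. (if y \<in> {a..<x} then k x y * f y * w y else 0) \<partial>lebesgue)"
    unfolding left_integral_def by (rule Lebesgue_Measure.integral_restrict_UNIV[symmetric]) simp
  also have "\<dots> = (\<integral>y. kernel_ext a b k x y * weighted a b w f y \<partial>lebesgue)"
    using assms by (intro Bochner_Integration.integral_cong)
      (auto simp: kernel_ext_def weighted_def triangle_def)
  finally show ?thesis .
qed

lemma right_integral_eq:
  assumes "x \<in> {a..b}"
  shows "right_integral b w k f x = (\<integral>y. kernel_ext a b k y x * weighted a b w f y \<partial>lebesgue)"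
proof -
  have "right_integral b w k f x = (\<integral>y. (if y \<in> {x<..b} then k y x * f y * w y else 0) \<partial>lebesgue)"
    unfolding right_integral_def by (rule Lebesgue_Measure.integral_restrict_UNIV[symmetric]) simp
  also have "\<dots> = (\<integral>y. kernel_ext a b k y x * weighted a b w f y \<partial>lebesgue)"
    using assms by (intro Bochner_Integration.integral_cong)
      (auto simp: kernel_ext_def weighted_def triangle_def)
  finally show ?thesis .
qed

text \<open>On the triangle the integral is 1, not the default 0 of a nonintegrable function, so
  integrability is automatic. Off the triangle no \<open>z\<close> satisfies
  \<open>y < z < x\<close> with all points in range, and the integrand vanishes identically.\<close>

lemma has_bochner_integral_kernel_delta:
  assumes "\<And>x y. (x, y) \<in> triangle a b \<Longrightarrow> kernel_delta w k1 k2 x y = 1"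
  shows "has_bochner_integral lebesgue
    (\<lambda>z. kernel_ext a b k1 x z * weighted a b w (\<lambda>_. 1) z * kernel_ext a b k2 z y)
    (if (x, y) \<in> triangle a b then 1 else 0)"
proof (cases "(x, y) \<in> triangle a b")
  case True
  let ?f = "\<lambda>z. kernel_ext a b k1 x z * weighted a b w (\<lambda>_. 1) z * kernel_ext a b k2 z y"
  have "kernel_delta w k1 k2 x y =
      (\<integral>z. (if z \<in> {y<..<x} then k1 x z * k2 z y * w z else 0) \<partial>lebesgue)"
    unfolding kernel_delta_def by (rule Lebesgue_Measure.integral_restrict_UNIV[symmetric]) simp
  also have "\<dots> = integral\<^sup>L lebesgue ?f"
    using True by (intro Bochner_Integration.integral_cong)
      (auto simp: kernel_ext_def weighted_def triangle_def)
  finally have "kernel_delta w k1 k2 x y = integral\<^sup>L lebesgue ?f" .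
  then have "integral\<^sup>L lebesgue ?f = 1" using assms True by simp
  then show ?thesis
    using True not_integrable_integral_eq[of lebesgue ?f] by (auto simp: has_bochner_integral_iff)
next
  case False
  then have "(\<lambda>z. kernel_ext a b k1 x z * weighted a b w (\<lambda>_. 1) z * kernel_ext a b k2 z y) = (\<lambda>z. 0)"
    by (auto simp: kernel_ext_def triangle_def)
  then show ?thesis using False by (simp add: has_bochner_integral_zero)
qed

text \<open>\<open>K\<close> and \<open>L\<close> are kept abstract so that both sides are
  instances: the extended kernels with \<open>S x = {a..<x}\<close>, and their transposes with
  \<open>S x = {x<..b}\<close>.\<close>

lemma kernel_integral_of_kernel_integral:
  assumes w: "weight a b w" and K: "case_prod K \<in> borel_measurable lebesgue" "\<And>x z. 0 \<le> K x z"
    and L: "case_prod L \<in> borel_measurable lebesgue" "\<And>z y. 0 \<le> L z y"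
    and \<phi>: "\<phi> \<in> L1 a b"
    and f: "AE z in lebesgue_on {a..b}. f z = (\<integral>y. L z y * weighted a b w \<phi> y \<partial>lebesgue)"
    and S: "\<And>x. x \<in> {a..b} \<Longrightarrow> S x \<in> sets borel"
    and comp: "\<And>x y. x \<in> {a..b} \<Longrightarrow>
      has_bochner_integral lebesgue (\<lambda>z. K x z * weighted a b w (\<lambda>_. 1) z * L z y) (indicator (S x) y)"
  shows "AE x in lebesgue_on {a..b}. (\<integral>z. K x z * weighted a b w f z \<partial>lebesgue) =
    (\<integral>y. indicator (S x) y * weighted a b w \<phi> y \<partial>lebesgue)"
proof -
  have "AE z in lebesgue. z \<in> {a..b} \<longrightarrow> f z = (\<integral>y. L z y * weighted a b w \<phi> y \<partial>lebesgue)"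
    using f by (simp add: AE_restrict_space_iff)
  then have "AE z in lebesgue. K x z * weighted a b w f z =
      K x z * weighted a b w (\<lambda>_. 1) z * (\<integral>y. L z y * weighted a b w \<phi> y \<partial>lebesgue)" for x
    by eventually_elim (simp add: weighted_def)
  from integral_lebesgue_cong_AE[OF this]
  have eq: "(\<integral>z. K x z * weighted a b w f z \<partial>lebesgue) =
    (\<integral>z. K x z * weighted a b w (\<lambda>_. 1) z * (\<integral>y. L z y * weighted a b w \<phi> y \<partial>lebesgue) \<partial>lebesgue)" for x .
  have "0 \<le> weighted a b w (\<lambda>_. 1) z" for z
    using w by (auto simp: weighted_def weight_def intro: less_imp_le)
  from iterated_integral_of_composed_kernels[OF K L weighted_one_measurable[OF w] this
      weighted_integrable[OF w \<phi>] S comp]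
  have "AE x in lborel. x \<in> {a..b} \<longrightarrow> (\<integral>z. K x z * weighted a b w f z \<partial>lebesgue) =
    (\<integral>y. indicator (S x) y * weighted a b w \<phi> y \<partial>lebesgue)"
    unfolding eq by blast
  from AE_completion[OF this] show ?thesis by (simp add: AE_restrict_space_iff)
qed

text \<open>Connects the Lebesgue integrals of the kernel calculus with the gauge integral used for
  differentiation. Allowing a null difference covers open and half-open intervals at once.\<close>

lemma integral_indicator_eq_Henstock_integral:
  fixes h :: "real \<Rightarrow> real"
  assumes h: "integrable lebesgue h" and A: "A \<in> sets lebesgue"
    and N: "negligible (A - {u..v} \<union> ({u..v} - A))"
  shows "(\<integral>y. indicator A y * h y \<partial>lebesgue) = integral {u..v} h"
proof -
  have "integrable (lebesgue_on {u..v}) h"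
    using integrable_mult_indicator[OF _ h, of "{u..v}"] by (simp add: integrable_restrict_space)
  from has_integral_integral_lebesgue_on[OF this]
  have "integral {u..v} h = integral\<^sup>L (lebesgue_on {u..v}) h" by (simp add: integral_unique)
  also have "\<dots> = (\<integral>y. indicator {u..v} y * h y \<partial>lebesgue)"
    by (simp add: integral_restrict_space)
  also have "\<dots> = (\<integral>y. indicator A y * h y \<partial>lebesgue)"
  proof (rule integral_lebesgue_cong_AE)
    show "AE y in lebesgue. indicator {u..v} y * h y = indicator A y * h y"
      unfolding eventually_ae_filter_negligible
      by (intro exI conjI, rule N) (auto simp: indicator_def)
  qed
  finally show ?thesis by simp
qed

text \<open>The constants serve both sides: \<open>c = 0\<close>, \<open>s = 1\<close> for integrals
  from \<open>a\<close>, and \<open>c = integral {a..b} h\<close>, \<open>s = -1\<close> for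
  integrals up to \<open>b\<close>.\<close>

lemma deriv_ac_rep_AE:
  fixes h g F :: "real \<Rightarrow> real"
  assumes h: "integrable lebesgue h"
    and F: "\<And>x. x \<in> {a..b} \<Longrightarrow> F x = c + s * integral {a..x} h" and s: "\<bar>s\<bar> = 1"
    and g: "AE x in lebesgue_on {a..b}. g x = F x"
  shows "is_ac_rep a b g F" and "AE x in lebesgue_on {a..b}. deriv (ac_rep a b g) x = s * h x"
proof -
  have hi: "h integrable_on {u..v}" for u v
    using integrable_mult_indicator[OF _ h, of "{u..v}"]
    by (intro integrable_on_lebesgue_on) (simp_all add: integrable_restrict_space)
  have "abs_continuous a b F"
  proof (rule abs_continuous_indefinite_integral[OF h])
    fix u v assume uv: "a \<le> u" "u \<le> v" "v \<le> b"
    have "F v - F u = s * (integral {a..v} h - integral {a..u} h)"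
      using uv by (simp add: F algebra_simps)
    also have "integral {a..v} h - integral {a..u} h = integral {u..v} h"
      using Henstock_Kurzweil_Integration.integral_combine[OF uv(1,2) hi] by simp
    also have "\<dots> = (\<integral>x. indicator {u<..<v} x * h x \<partial>lebesgue)"
      by (rule integral_indicator_eq_Henstock_integral[OF h, symmetric])
        (simp, rule negligible_subset[of "{u, v}"], auto)
    finally show "\<bar>F v - F u\<bar> = \<bar>\<integral>x. indicator {u<..<v} x * h x \<partial>lebesgue\<bar>"
      using s by (simp add: abs_mult)
  qed
  with g show ac: "is_ac_rep a b g F" by (simp add: is_ac_rep_def)
  let ?N = "{x \<in> {a<..<b}. \<not> ((\<lambda>x. integral {a..x} h) has_real_derivative h x) (at x)}"
  have "negligible (?N \<union> {a, b})"
    using negligible_not_has_real_derivative_indefinite_integral[OF hi, of a b] by auto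
  moreover have "{x. \<not> (x \<in> {a..b} \<longrightarrow> deriv (ac_rep a b g) x = s * h x)} \<subseteq> ?N \<union> {a, b}"
  proof (rule subsetI, rule ccontr)
    fix x assume x: "x \<in> {x. \<not> (x \<in> {a..b} \<longrightarrow> deriv (ac_rep a b g) x = s * h x)}"
      and "x \<notin> ?N \<union> {a, b}"
    then have ab: "x \<in> {a<..<b}" and "((\<lambda>x. integral {a..x} h) has_real_derivative h x) (at x)"
      by auto
    then have "((\<lambda>x. c + s * integral {a..x} h) has_real_derivative s * h x) (at x)"
      by (auto intro!: derivative_eq_intros)
    \<comment> \<open>The chosen representative coincides with \<open>F\<close> on the whole open
      interval, not just at \<open>x\<close>, so the derivative carries over.\<close>
    then have "(ac_rep a b g has_real_derivative s * h x) (at x)"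
      by (rule has_field_derivative_transform_within_open[where S = "{a<..<b}"])
        (use ab ac_rep_eq[OF ac] F in auto)
    then show False using x by (auto dest: DERIV_imp_deriv)
  qed
  ultimately have "AE x in lebesgue. x \<in> {a..b} \<longrightarrow> deriv (ac_rep a b g) x = s * h x"
    unfolding eventually_ae_filter_negligible by blast
  then show "AE x in lebesgue_on {a..b}. deriv (ac_rep a b g) x = s * h x"
    by (simp add: AE_restrict_space_iff)
qed

section \<open>Inversion formulas on the two sides\<close>

lemma L1_cong_AE:
  assumes "f \<in> L1 a b" and "AE x in lebesgue_on {a..b}. f x = g x"
  shows "g \<in> L1 a b"
proof -
  have "AE x in lebesgue. x \<in> {a..b} \<longrightarrow> f x = g x"
    using assms(2) by (simp add: AE_restrict_space_iff)
  then have "AE x in lebesgue. (if x \<in> {a..b} then f x else 0) = (if x \<in> {a..b} then g x else 0)"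
    by eventually_elim auto
  from integrable_lebesgue_cong_AE[OF this] assms(1) show ?thesis by (simp only: L1_iff)
qed

text \<open>Permits replacing \<open>\<phi>\<close> by the derivative under a kernel integral,
  although the two agree only almost everywhere.\<close>

lemma integral_weighted_cong_AE:
  assumes "AE x in lebesgue_on {a..b}. f x = g x"
  shows "(\<integral>y. p y * weighted a b w f y \<partial>lebesgue) = (\<integral>y. p y * weighted a b w g y \<partial>lebesgue)"
proof (rule integral_lebesgue_cong_AE)
  have "AE x in lebesgue. x \<in> {a..b} \<longrightarrow> f x = g x"
    using assms by (simp add: AE_restrict_space_iff)
  then show "AE y in lebesgue. p y * weighted a b w f y = p y * weighted a b w g y"
    by eventually_elim (simp add: weighted_def)
qed

lemma left_integral_left_deriv:
  assumes w: "weight a b w" and conj: "conjugate_kernels a b w k k'"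
    and f: "f \<in> left_range a b w k"
  shows "has_left_deriv a b w k' f \<and> left_deriv a b w k' f \<in> L1 a b \<and>
    (AE x in lebesgue_on {a..b}. left_integral a w k (left_deriv a b w k' f) x = f x)"
proof -
  have k: "k \<in> kernels a b w" and k': "k' \<in> kernels a b w"
    and delta: "\<And>x y. (x, y) \<in> triangle a b \<Longrightarrow> kernel_delta w k' k x y = 1"
    using conj by (auto simp: conjugate_kernels_def)
  obtain \<phi> where fL1: "f \<in> L1 a b" and \<phi>: "\<phi> \<in> L1 a b"
    and f\<phi>: "AE x in lebesgue_on {a..b}. f x = left_integral a w k \<phi> x"
    using f by (auto simp: left_range_def)
  let ?h = "weighted a b w \<phi>"
  define F where "F = (\<lambda>x. \<integral>y. indicator {a..<x} y * ?h y \<partial>lebesgue)"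
  note h = weighted_integrable[OF w \<phi>]
  have f\<phi>': "AE z in lebesgue_on {a..b}. f z = (\<integral>y. kernel_ext a b k z y * ?h y \<partial>lebesgue)"
    using f\<phi> AE_space by eventually_elim (simp add: left_integral_eq[where a = a and b = b])
  have "has_bochner_integral lebesgue
      (\<lambda>z. kernel_ext a b k' x z * weighted a b w (\<lambda>_. 1) z * kernel_ext a b k z y) (indicator {a..<x} y)"
    if "x \<in> {a..b}" for x y
  proof -
    have "has_bochner_integral lebesgue
      (\<lambda>z. kernel_ext a b k' x z * weighted a b w (\<lambda>_. 1) z * kernel_ext a b k z y)
      (if (x, y) \<in> triangle a b then 1 else 0)"
      by (rule has_bochner_integral_kernel_delta) (rule delta)
    moreover have "(if (x, y) \<in> triangle a b then 1 else 0 :: real) = indicator {a..<x} y"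
      using that by (auto simp: triangle_def indicator_def)
    ultimately show ?thesis by simp
  qed
  from kernel_integral_of_kernel_integral[OF w kernel_ext_measurable[OF k'] kernel_ext_nonneg[OF k']
      kernel_ext_measurable[OF k] kernel_ext_nonneg[OF k] \<phi> f\<phi>' _ this]
  have "AE x in lebesgue_on {a..b}. (\<integral>z. kernel_ext a b k' x z * weighted a b w f z \<partial>lebesgue) = F x"
    by (simp add: F_def)
  then have gF: "AE x in lebesgue_on {a..b}. left_integral a w k' f x = F x"
    using AE_space by eventually_elim (simp add: left_integral_eq[where a = a and b = b])
  have F: "F x = 0 + 1 * integral {a..x} ?h" for x
  proof -
    have "negligible ({a..<x} - {a..x} \<union> ({a..x} - {a..<x}))"
      by (rule negligible_subset[of "{x}"]) auto
    then show ?thesis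
      using integral_indicator_eq_Henstock_integral[OF h, of "{a..<x}" a x] by (simp add: F_def)
  qed
  note ac = deriv_ac_rep_AE[OF h F _ gF, simplified]
  have D: "AE x in lebesgue_on {a..b}. \<phi> x = left_deriv a b w k' f x"
    using ac(2) AE_space
  proof eventually_elim
    case (elim x)
    moreover have "w x > 0" using elim w by (auto simp: weight_def)
    ultimately show ?case by (simp add: left_deriv_def weighted_def)
  qed
  have "AE x in lebesgue_on {a..b}. left_integral a w k (left_deriv a b w k' f) x = f x"
    using f\<phi> AE_space
    by eventually_elim (simp add: left_integral_eq[where a = a and b = b] integral_weighted_cong_AE[OF D])
  moreover have "has_left_deriv a b w k' f"
    using fL1 ac(1) by (auto simp: has_left_deriv_def has_ac_rep_def)
  ultimately show ?thesis using L1_cong_AE[OF \<phi> D] by blast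
qed

text \<open>Transposition reverses the order of composition, which is why the other conjugacy
  relation is the one used here.\<close>

lemma right_integral_right_deriv:
  assumes w: "weight a b w" and conj: "conjugate_kernels a b w k k'"
    and f: "f \<in> right_range a b w k"
  shows "has_right_deriv a b w k' f \<and> right_deriv a b w k' f \<in> L1 a b \<and>
    (AE x in lebesgue_on {a..b}. right_integral b w k (right_deriv a b w k' f) x = f x)"
proof -
  have k: "k \<in> kernels a b w" and k': "k' \<in> kernels a b w"
    and delta: "\<And>x y. (x, y) \<in> triangle a b \<Longrightarrow> kernel_delta w k k' x y = 1"
    using conj by (auto simp: conjugate_kernels_def)
  obtain \<phi> where fL1: "f \<in> L1 a b" and \<phi>: "\<phi> \<in> L1 a b"
    and f\<phi>: "AE x in lebesgue_on {a..b}. f x = right_integral b w k \<phi> x"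
    using f by (auto simp: right_range_def)
  let ?h = "weighted a b w \<phi>"
  define F where "F = (\<lambda>x. \<integral>y. indicator {x<..b} y * ?h y \<partial>lebesgue)"
  note h = weighted_integrable[OF w \<phi>]
  have f\<phi>': "AE z in lebesgue_on {a..b}. f z = (\<integral>y. kernel_ext a b k y z * ?h y \<partial>lebesgue)"
    using f\<phi> AE_space by eventually_elim (simp add: right_integral_eq[where a = a and b = b])
  have swap: "(\<lambda>(x, y). kernel_ext a b k y x) \<in> borel_measurable lebesgue" if "k \<in> kernels a b w" for k
    using borel_measurable_lebesgue_swap[OF kernel_ext_measurable[OF that]]
    by (simp add: case_prod_unfold)
  have "has_bochner_integral lebesgue
      (\<lambda>z. kernel_ext a b k' z x * weighted a b w (\<lambda>_. 1) z * kernel_ext a b k y z) (indicator {x<..b} y)"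
    if "x \<in> {a..b}" for x y
  proof -
    \<comment> \<open>The composite of the transposed kernels at \<open>(x, y)\<close> is that of
      the original ones at \<open>(y, x)\<close>, with the factors interchanged.\<close>
    have "has_bochner_integral lebesgue
      (\<lambda>z. kernel_ext a b k y z * weighted a b w (\<lambda>_. 1) z * kernel_ext a b k' z x)
      (if (y, x) \<in> triangle a b then 1 else 0)"
      by (rule has_bochner_integral_kernel_delta) (rule delta)
    moreover have "(if (y, x) \<in> triangle a b then 1 else 0 :: real) = indicator {x<..b} y"
      using that by (auto simp: triangle_def indicator_def)
    ultimately show ?thesis by (simp add: mult_ac)
  qed
  from kernel_integral_of_kernel_integral[OF w swap[OF k'] kernel_ext_nonneg[OF k']
      swap[OF k] kernel_ext_nonneg[OF k] \<phi> f\<phi>' _ this]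
  have "AE x in lebesgue_on {a..b}. (\<integral>z. kernel_ext a b k' z x * weighted a b w f z \<partial>lebesgue) = F x"
    by (simp add: F_def)
  then have gF: "AE x in lebesgue_on {a..b}. right_integral b w k' f x = F x"
    using AE_space by eventually_elim (simp add: right_integral_eq[where a = a and b = b])
  \<comment> \<open>The integral up to \<open>b\<close> is a constant minus the primitive from
    \<open>a\<close>; the resulting sign cancels the one in \<open>right_deriv\<close>.\<close>
  have F: "F x = integral {a..b} ?h + (-1) * integral {a..x} ?h" if x: "x \<in> {a..b}" for x
  proof -
    have "?h integrable_on {a..b}"
      using integrable_mult_indicator[OF _ h, of "{a..b}"]
      by (intro integrable_on_lebesgue_on) (simp_all add: integrable_restrict_space)
    from Henstock_Kurzweil_Integration.integral_combine[OF _ _ this, of x] x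
    have "integral {a..b} ?h + (-1) * integral {a..x} ?h = integral {x..b} ?h" by simp
    moreover have "negligible ({x<..b} - {x..b} \<union> ({x..b} - {x<..b}))"
      by (rule negligible_subset[of "{x}"]) auto
    ultimately show ?thesis
      using integral_indicator_eq_Henstock_integral[OF h, of "{x<..b}" x b] by (simp add: F_def)
  qed
  note ac = deriv_ac_rep_AE[OF h F _ gF, simplified]
  have D: "AE x in lebesgue_on {a..b}. \<phi> x = right_deriv a b w k' f x"
    using ac(2) AE_space
  proof eventually_elim
    case (elim x)
    moreover have "w x > 0" using elim w by (auto simp: weight_def)
    ultimately show ?case by (simp add: right_deriv_def weighted_def)
  qed
  have "AE x in lebesgue_on {a..b}. right_integral b w k (right_deriv a b w k' f) x = f x"
    using f\<phi> AE_space
    by eventually_elim (simp add: right_integral_eq[where a = a and b = b] integral_weighted_cong_AE[OF D])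
  moreover have "has_right_deriv a b w k' f"
    using fL1 ac(1) by (auto simp: has_right_deriv_def has_ac_rep_def)
  ultimately show ?thesis using L1_cong_AE[OF \<phi> D] by blast
qed

theorem theorem4p9:
  fixes a b :: real
    and w :: "real \<Rightarrow> real"
    and k k' :: "real \<Rightarrow> real \<Rightarrow> real"
  assumes "a < b"
    and "weight a b w"
    and "k' \<in> kernels a b w"
    and "k \<in> conj_set a b w k'"
  shows "(\<forall>f\<in>left_range a b w k.
            has_left_deriv a b w k' f \<and>
            left_deriv a b w k' f \<in> L1 a b \<and>
            (AE x in lebesgue_on {a..b}. left_integral a w k (left_deriv a b w k' f) x = f x)) \<and>
         (\<forall>f\<in>right_range a b w k.
            has_right_deriv a b w k' f \<and>
            right_deriv a b w k' f \<in> L1 a b \<and>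
            (AE x in lebesgue_on {a..b}. right_integral b w k (right_deriv a b w k' f) x = f x))"
  using assms left_integral_left_deriv right_integral_right_deriv by (auto simp: conj_set_def)

end
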